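(* Let $\mathcal{U}$ be a non-principal ultrafilter on $\omega$. Then, for any uncountable cardinal $\kappa$, $[\kappa]^{<\omega}\leq_T\mathcal{U}$ if and only if $\tau_\kappa^\diamond\leq_K\mathcal{U}^*$.
   Context: For directed partial orders $\mathbb{P},\mathbb{Q}$, $\mathbb{Q}\leq_T\mathbb{P}$ means there is a map $P\to Q$ sending cofinal subsets of $\mathbb{P}$ to cofinal subsets of $\mathbb{Q}$. $\mathcal{U}$ is ordered by $\supseteq$ and $[\kappa]^{<\omega}$ by $\subseteq$. For ideals $\mathscr{I},\mathscr{J}$, $\mathscr{I}\leq_K\mathscr{J}$ means there is $f:\bigcup\mathscr{J}\to\bigcup\mathscr{I}$ with $f^{-1}[A]\in\mathscr{J}$ for all $A\in\mathscr{I}$. $\mathcal{U}^*=\{\omega\setminus A:A\in\mathcal{U}\}$. For $A\in[\kappa]^\omega$ (a countably infinite subset of $\kappa$) and $f:A\to 2$, let $\chi(A,f)=\{x\in 2^\kappa:x\upharpoonright A=f\}$ and let $\chi_\omega(A,f)=[\chi(A,f)]^\omega$ be the family of countably infinite subsets of $\chi(A,f)$. $\tau_\kappa^\diamond$ is the ideal on $2^\kappa$ generated by $\bigcup_{A\in[\kappa]^\omega}\bigcup_{f\in 2^A}\chi_\omega(A,f)$. *)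

theory Defs
  imports HOL.Hull "HOL-Library.Countable_Set" "HOL-Library.FuncSet"
begin

definition ultrafilter_on :: "'a set \<Rightarrow> 'a set set \<Rightarrow> bool" where
  "ultrafilter_on X U \<longleftrightarrow>
     U \<subseteq> Pow X \<and> X \<in> U \<and> {} \<notin> U \<and>
     (\<forall>A\<in>U. \<forall>B\<in>U. A \<inter> B \<in> U) \<and>
     (\<forall>A\<in>U. \<forall>B. A \<subseteq> B \<and> B \<subseteq> X \<longrightarrow> B \<in> U) \<and>
     (\<forall>A. A \<subseteq> X \<longrightarrow> A \<in> U \<or> X - A \<in> U)"

definition principal_on :: "'a set \<Rightarrow> 'a set set \<Rightarrow> bool" where
  "principal_on X U \<longleftrightarrow> (\<exists>x\<in>X. U = {A. A \<subseteq> X \<and> x \<in> A})"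

definition dual_family :: "'a set \<Rightarrow> 'a set set \<Rightarrow> 'a set set" where
  "dual_family X U = {X - A |A. A \<in> U}"

(* A partial order is given by its carrier P and its relation leP, which matters on P only.
   HOL's constant "cofinal" asks for strict bounds, so it fails for orders with a maximum. *)
definition cofinal_in :: "'p set \<Rightarrow> ('p \<Rightarrow> 'p \<Rightarrow> bool) \<Rightarrow> 'p set \<Rightarrow> bool" where
  "cofinal_in P leP C \<longleftrightarrow> C \<subseteq> P \<and> (\<forall>p\<in>P. \<exists>c\<in>C. leP p c)"

(* (Q, leQ) is Tukey reducible to (P, leP). *)
definition tukey_le ::
    "'q set \<Rightarrow> ('q \<Rightarrow> 'q \<Rightarrow> bool) \<Rightarrow> 'p set \<Rightarrow> ('p \<Rightarrow> 'p \<Rightarrow> bool) \<Rightarrow> bool" where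
  "tukey_le Q leQ P leP \<longleftrightarrow>
     (\<exists>f \<in> P \<rightarrow> Q. \<forall>C. cofinal_in P leP C \<longrightarrow> cofinal_in Q leQ (f ` C))"

(* Properness is not required. *)
definition ideal_on :: "'a set \<Rightarrow> 'a set set \<Rightarrow> bool" where
  "ideal_on X I \<longleftrightarrow>
     I \<subseteq> Pow X \<and> {} \<in> I \<and>
     (\<forall>A\<in>I. \<forall>B. B \<subseteq> A \<longrightarrow> B \<in> I) \<and>
     (\<forall>A\<in>I. \<forall>B\<in>I. A \<union> B \<in> I)"

definition katetov_le :: "'a set set \<Rightarrow> 'b set set \<Rightarrow> bool" where
  "katetov_le I J \<longleftrightarrow> (\<exists>f \<in> \<Union>J \<rightarrow> \<Union>I. \<forall>A\<in>I. f -` A \<inter> \<Union>J \<in> J)"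

definition countably_infinite_subsets :: "'a set \<Rightarrow> 'a set set" where
  "countably_infinite_subsets S = {B. B \<subseteq> S \<and> countable B \<and> infinite B}"

(* The functions from A to 2 are rendered as extensional functions into bool. *)
definition two_pow :: "'k set \<Rightarrow> ('k \<Rightarrow> bool) set" where
  "two_pow A = A \<rightarrow>\<^sub>E UNIV"

definition chi :: "'k set \<Rightarrow> 'k set \<Rightarrow> ('k \<Rightarrow> bool) \<Rightarrow> ('k \<Rightarrow> bool) set" where
  "chi K A f = {x \<in> two_pow K. restrict x A = f}"

definition chi_omega :: "'k set \<Rightarrow> 'k set \<Rightarrow> ('k \<Rightarrow> bool) \<Rightarrow> ('k \<Rightarrow> bool) set set" where
  "chi_omega K A f = countably_infinite_subsets (chi K A f)"

definition tau_diamond :: "'k set \<Rightarrow> ('k \<Rightarrow> bool) set set" where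
  "tau_diamond K =
     ideal_on (two_pow K) hull
       (\<Union>A \<in> countably_infinite_subsets K. \<Union>f \<in> two_pow A. chi_omega K A f)"

end

theory Submission
  imports Defs
begin

text \<open>
  Both sides are equivalent to the existence of a family \<open>A\<close> of members of \<open>U\<close>, indexed by
  \<open>\<kappa>\<close>, such that no intersection over an infinite index set lies in \<open>U\<close>.
  From a cofinal map \<open>f\<close> choose \<open>A k\<close> such that \<open>k \<in> f B\<close> for all \<open>B \<subseteq> A k\<close> in \<open>U\<close>;
  conversely send \<open>B\<close> to \<open>{k. B \<subseteq> A k}\<close>. A Katetov map \<open>g\<close> into \<open>2\<^sup>\<kappa>\<close> corresponds to \<open>A\<close> through
  \<open>A k = {n. g n k = e k}\<close>, where the bit \<open>e k\<close> is the one that puts this set into \<open>U\<close>: on an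
  intersection of the \<open>A k\<close> over \<open>k \<in> I\<close> the map \<open>g\<close> takes values in a single \<open>\<chi>(I, e)\<close>.
\<close>

section \<open>Ultrafilters and their dual ideals\<close>

lemma ultrafilter_onD:
  assumes "ultrafilter_on X U"
  shows "A \<in> U \<Longrightarrow> A \<subseteq> X" and "X \<in> U" and "{} \<notin> U"
    and "A \<in> U \<Longrightarrow> B \<in> U \<Longrightarrow> A \<inter> B \<in> U"
    and "A \<in> U \<Longrightarrow> A \<subseteq> B \<Longrightarrow> B \<subseteq> X \<Longrightarrow> B \<in> U"
    and "A \<subseteq> X \<Longrightarrow> A \<notin> U \<Longrightarrow> X - A \<in> U"
  using assms unfolding ultrafilter_on_def by blast+

lemma ultrafilter_on_finite_INT:
  assumes U: "ultrafilter_on X U" and "finite F" and "\<forall>k\<in>F. A k \<in> U"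
  shows "X \<inter> (\<Inter>k\<in>F. A k) \<in> U"
  using assms(2,3)
proof (induction F rule: finite_induct)
  case empty
  then show ?case using ultrafilter_onD(2)[OF U] by simp
next
  case (insert k F)
  then have "A k \<inter> (X \<inter> (\<Inter>k\<in>F. A k)) \<in> U"
    using ultrafilter_onD(4)[OF U] by simp
  moreover have "A k \<inter> (X \<inter> (\<Inter>k\<in>F. A k)) = X \<inter> (\<Inter>k\<in>insert k F. A k)" by auto
  ultimately show ?case by simp
qed

lemma mem_dual_family_iff:
  assumes U: "ultrafilter_on X U"
  shows "B \<in> dual_family X U \<longleftrightarrow> B \<subseteq> X \<and> B \<notin> U"
proof
  assume "B \<in> dual_family X U"
  then obtain A where A: "A \<in> U" "B = X - A" unfolding dual_family_def by blast
  have "A \<inter> B = {}" using A(2) by blast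
  then show "B \<subseteq> X \<and> B \<notin> U"
    using A ultrafilter_onD(3,4)[OF U] by (metis Diff_subset)
next
  assume B: "B \<subseteq> X \<and> B \<notin> U"
  then have "X - B \<in> U" using ultrafilter_onD(6)[OF U] by blast
  moreover have "B = X - (X - B)" using B by blast
  ultimately show "B \<in> dual_family X U" unfolding dual_family_def by blast
qed

lemma ideal_on_dual_family:
  assumes U: "ultrafilter_on X U"
  shows "ideal_on X (dual_family X U)"
  unfolding ideal_on_def
proof (intro conjI ballI allI impI)
  show "dual_family X U \<subseteq> Pow X" and "{} \<in> dual_family X U"
    using mem_dual_family_iff[OF U] ultrafilter_onD(3)[OF U] by auto
next
  fix A B assume "A \<in> dual_family X U" and "B \<subseteq> A"
  then show "B \<in> dual_family X U"
    using mem_dual_family_iff[OF U] ultrafilter_onD(5)[OF U] by (meson subset_trans)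
next
  fix A B assume "A \<in> dual_family X U" and "B \<in> dual_family X U"
  then obtain A' B' where "A' \<in> U" "B' \<in> U" "A = X - A'" "B = X - B'"
    unfolding dual_family_def by blast
  then have "A \<union> B = X - A' \<inter> B'" and "A' \<inter> B' \<in> U"
    using ultrafilter_onD(4)[OF U] by auto
  then show "A \<union> B \<in> dual_family X U" unfolding dual_family_def by blast
qed

text \<open>Preimages commute with unions and respect inclusion. With the dual ideal of
  \<open>U\<close> as \<open>I\<close>, this reduces the Katetov condition on a generated ideal to
  its generators.\<close>

lemma ideal_on_pushforward:
  assumes "ideal_on X I"
  shows "ideal_on Y {B. B \<subseteq> Y \<and> f -` B \<inter> X \<in> I}"
proof -
  have empty: "{} \<in> I"
    and down: "\<And>A B. A \<in> I \<Longrightarrow> B \<subseteq> A \<Longrightarrow> B \<in> I"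
    and union: "\<And>A B. A \<in> I \<Longrightarrow> B \<in> I \<Longrightarrow> A \<union> B \<in> I"
    using assms by (simp_all add: ideal_on_def)
  show ?thesis
    unfolding ideal_on_def
  proof (intro conjI ballI allI impI)
    fix B C assume B: "B \<in> {B. B \<subseteq> Y \<and> f -` B \<inter> X \<in> I}" and CB: "C \<subseteq> B"
    have "f -` B \<inter> X \<in> I" using B by simp
    then have "f -` C \<inter> X \<in> I" by (rule down) (use CB in blast)
    with B CB show "C \<in> {B. B \<subseteq> Y \<and> f -` B \<inter> X \<in> I}" by auto
  next
    fix B C assume "B \<in> {B. B \<subseteq> Y \<and> f -` B \<inter> X \<in> I}"
      and "C \<in> {B. B \<subseteq> Y \<and> f -` B \<inter> X \<in> I}"
    then show "B \<union> C \<in> {B. B \<subseteq> Y \<and> f -` B \<inter> X \<in> I}"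
      by (simp add: vimage_Un Int_Un_distrib2 union)
  qed (use empty in auto)
qed

lemma singleton_notin_nonprincipal:
  assumes U: "ultrafilter_on X U" and np: "\<not> principal_on X U" and x: "x \<in> X"
  shows "{x} \<notin> U"
proof
  assume xU: "{x} \<in> U"
  have "U = {A. A \<subseteq> X \<and> x \<in> A}"
  proof (intro equalityI subsetI)
    fix A assume A: "A \<in> U"
    have "A \<inter> {x} \<noteq> {}"
      using ultrafilter_onD(3)[OF U] ultrafilter_onD(4)[OF U A xU] by metis
    then show "A \<in> {A. A \<subseteq> X \<and> x \<in> A}" using ultrafilter_onD(1)[OF U A] by simp
  next
    fix A assume "A \<in> {A. A \<subseteq> X \<and> x \<in> A}"
    then show "A \<in> U" using ultrafilter_onD(5)[OF U xU] by blast
  qed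
  with np x show False unfolding principal_on_def by blast
qed

text \<open>Non-principality puts every singleton into the dual ideal, so a Katetov map into
  \<open>tau_diamond K\<close> is defined on all of \<open>X\<close>.\<close>

lemma Union_dual_family:
  assumes U: "ultrafilter_on X U" and "\<not> principal_on X U"
  shows "\<Union>(dual_family X U) = X"
  using singleton_notin_nonprincipal[OF assms] mem_dual_family_iff[OF U] by blast

section \<open>Tukey reductions and families without infinite intersections in
  \<open>U\<close>\<close>

lemma tukey_le_Fpow_iff:
  assumes U: "ultrafilter_on X U"
  shows "tukey_le (Fpow K) (\<subseteq>) U (\<supseteq>) \<longleftrightarrow>
    (\<exists>A. (\<forall>k\<in>K. A k \<in> U) \<and> (\<forall>I\<subseteq>K. infinite I \<longrightarrow> (\<Inter>k\<in>I. A k) \<notin> U))"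
proof
  assume "tukey_le (Fpow K) (\<subseteq>) U (\<supseteq>)"
  then obtain f where f: "f \<in> U \<rightarrow> Fpow K"
    and cof: "\<And>C. cofinal_in U (\<supseteq>) C \<Longrightarrow> cofinal_in (Fpow K) (\<subseteq>) (f ` C)"
    unfolding tukey_le_def by blast
  have "\<exists>A\<in>U. \<forall>B\<in>U. B \<subseteq> A \<longrightarrow> k \<in> f B" if k: "k \<in> K" for k
  proof (rule ccontr)
    assume "\<not> ?thesis"
    \<comment> \<open>Every member of \<open>U\<close> would contain some \<open>B\<close> in
      \<open>U\<close> with \<open>k \<notin> f B\<close>. The image of these \<open>B\<close> would
      be cofinal, yet none of its members lies above \<open>{k}\<close>.\<close>
    then have "cofinal_in U (\<supseteq>) {B\<in>U. k \<notin> f B}" unfolding cofinal_in_def by blast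
    then have "cofinal_in (Fpow K) (\<subseteq>) (f ` {B\<in>U. k \<notin> f B})" by (rule cof)
    moreover have "{k} \<in> Fpow K" using k by (simp add: Fpow_def)
    ultimately show False unfolding cofinal_in_def by fastforce
  qed
  then obtain A where A: "\<And>k. k \<in> K \<Longrightarrow> A k \<in> U"
    and A': "\<And>k B. k \<in> K \<Longrightarrow> B \<in> U \<Longrightarrow> B \<subseteq> A k \<Longrightarrow> k \<in> f B" by metis
  have "(\<Inter>k\<in>I. A k) \<notin> U" if I: "I \<subseteq> K" "infinite I" for I
  proof
    assume B: "(\<Inter>k\<in>I. A k) \<in> U"
    \<comment> \<open>The intersection is itself a member of \<open>U\<close> below each
      \<open>A k\<close>, so its value under \<open>f\<close> contains all of \<open>I\<close>,
      although that value is finite.\<close>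
    then have "I \<subseteq> f (\<Inter>k\<in>I. A k)" using I(1) by (blast intro: A')
    moreover have "finite (f (\<Inter>k\<in>I. A k))" using f B by (auto simp: Fpow_def)
    ultimately show False using I(2) finite_subset by blast
  qed
  with A show "\<exists>A. (\<forall>k\<in>K. A k \<in> U) \<and> (\<forall>I\<subseteq>K. infinite I \<longrightarrow> (\<Inter>k\<in>I. A k) \<notin> U)" by blast
next
  assume "\<exists>A. (\<forall>k\<in>K. A k \<in> U) \<and> (\<forall>I\<subseteq>K. infinite I \<longrightarrow> (\<Inter>k\<in>I. A k) \<notin> U)"
  then obtain A where A: "\<And>k. k \<in> K \<Longrightarrow> A k \<in> U"
    and A': "\<And>I. I \<subseteq> K \<Longrightarrow> infinite I \<Longrightarrow> (\<Inter>k\<in>I. A k) \<notin> U" by blast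
  define f where "f B = {k\<in>K. B \<subseteq> A k}" for B
  have f: "f B \<in> Fpow K" if B: "B \<in> U" for B
  proof -
    have "finite (f B)"
    proof (rule ccontr)
      assume inf: "infinite (f B)"
      \<comment> \<open>One index is needed to bound the intersection by \<open>X\<close>, since the
        empty intersection is \<open>UNIV\<close>.\<close>
      then obtain k where "k \<in> f B" using infinite_imp_nonempty by blast
      then have "(\<Inter>k\<in>f B. A k) \<subseteq> X"
        using ultrafilter_onD(1)[OF U A] unfolding f_def by blast
      moreover have "B \<subseteq> (\<Inter>k\<in>f B. A k)" unfolding f_def by blast
      ultimately have "(\<Inter>k\<in>f B. A k) \<in> U" using ultrafilter_onD(5)[OF U B] by blast
      moreover have "f B \<subseteq> K" unfolding f_def by blast
      ultimately show False using A' inf by blast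
    qed
    then show ?thesis by (auto simp: Fpow_def f_def)
  qed
  have "cofinal_in (Fpow K) (\<subseteq>) (f ` C)" if C: "cofinal_in U (\<supseteq>) C" for C
    unfolding cofinal_in_def
  proof (intro conjI ballI)
    show "f ` C \<subseteq> Fpow K" using C f unfolding cofinal_in_def by blast
  next
    fix F assume F: "F \<in> Fpow K"
    \<comment> \<open>A member of \<open>C\<close> below this finite intersection is sent above
      \<open>F\<close>; the factor \<open>X\<close> covers the case of empty
      \<open>F\<close>.\<close>
    then have "X \<inter> (\<Inter>k\<in>F. A k) \<in> U"
      using ultrafilter_on_finite_INT[OF U, of F A] A by (auto simp: Fpow_def)
    then obtain c where "c \<in> C" "c \<subseteq> X \<inter> (\<Inter>k\<in>F. A k)"
      using C unfolding cofinal_in_def by blast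
    moreover from this F have "F \<subseteq> f c" by (auto simp: f_def Fpow_def)
    ultimately show "\<exists>c\<in>f ` C. F \<subseteq> c" by blast
  qed
  with f show "tukey_le (Fpow K) (\<subseteq>) U (\<supseteq>)" unfolding tukey_le_def by blast
qed

section \<open>The ideal \<open>tau_diamond K\<close> and its underlying set\<close>

lemma tau_diamond_least:
  assumes "ideal_on (two_pow K) I"
    and "\<And>A g B. A \<in> countably_infinite_subsets K \<Longrightarrow> B \<in> chi_omega K A g \<Longrightarrow> B \<in> I"
  shows "tau_diamond K \<subseteq> I"
  unfolding tau_diamond_def using assms by (intro hull_minimal) blast+

lemma tau_diamond_subset_Pow: "tau_diamond K \<subseteq> Pow (two_pow K)"
proof (rule tau_diamond_least)
  show "ideal_on (two_pow K) (Pow (two_pow K))" by (auto simp: ideal_on_def)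
next
  fix A g B assume "B \<in> chi_omega K A g"
  then show "B \<in> Pow (two_pow K)"
    by (auto simp: chi_omega_def countably_infinite_subsets_def chi_def)
qed

text \<open>A countable \<open>A\<close> leaves infinitely many coordinates of \<open>K\<close>
  free. Extending \<open>g\<close> by the indicator of a single free coordinate \<open>k\<close>
  gives distinct points for distinct \<open>k\<close>.\<close>

lemma infinite_chi:
  assumes "uncountable K" and "countable A" and "A \<subseteq> K" and g: "g \<in> two_pow A"
  shows "infinite (chi K A g)"
proof -
  define x where "x k = restrict (\<lambda>j. if j \<in> A then g j else j = k) K" for k
  have "inj_on x (K - A)"
  proof (rule inj_onI)
    fix k l assume k: "k \<in> K - A" and "x k = x l"
    then have "x k k = x l k" by simp
    with k show "k = l" by (simp add: x_def)
  qed
  moreover have "infinite (K - A)"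
    using assms(1,2) uncountable_minus_countable uncountable_infinite by blast
  moreover have "x ` (K - A) \<subseteq> chi K A g"
  proof
    fix y assume "y \<in> x ` (K - A)"
    then obtain k where y: "y = x k" by blast
    have "restrict (x k) A = g"
    proof
      fix j show "restrict (x k) A j = g j"
        using g \<open>A \<subseteq> K\<close> by (auto simp: x_def two_pow_def PiE_def extensional_def)
    qed
    then show "y \<in> chi K A g" by (simp add: y chi_def two_pow_def x_def)
  qed
  ultimately show ?thesis by (meson finite_imageD finite_subset)
qed

text \<open>Generators are infinite, but \<open>B\<close> may be finite. Adjoining a countably
  infinite \<open>D\<close> from the same \<open>chi K A g\<close> gives a generator that covers
  \<open>B\<close>.\<close>

lemma countable_subset_chi_in_tau_diamond:
  assumes K: "uncountable K" and A: "A \<in> countably_infinite_subsets K"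
    and g: "g \<in> two_pow A" and B: "countable B" "B \<subseteq> chi K A g"
  shows "B \<in> tau_diamond K"
proof -
  have "infinite (chi K A g)"
    using infinite_chi[OF K _ _ g] A by (simp add: countably_infinite_subsets_def)
  then obtain D where D: "D \<subseteq> chi K A g" "countable D" "infinite D"
    using infinite_countable_subset' by blast
  then have BD: "B \<union> D \<in> chi_omega K A g"
    using B by (simp add: chi_omega_def countably_infinite_subsets_def)
  have "B \<in> I" if "ideal_on (two_pow K) I"
    and "(\<Union>A \<in> countably_infinite_subsets K. \<Union>f \<in> two_pow A. chi_omega K A f) \<subseteq> I" for I
  proof -
    have "B \<union> D \<in> I" using that(2) A g BD by blast
    then show ?thesis using that(1) unfolding ideal_on_def by blast
  qed
  then show ?thesis unfolding tau_diamond_def hull_def by blast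
qed

text \<open>For any fixed countably infinite \<open>A\<close>, each point \<open>x\<close> lies in
  \<open>chi K A (restrict x A)\<close>, so its singleton is in the ideal.\<close>

lemma Union_tau_diamond:
  assumes K: "uncountable K"
  shows "\<Union>(tau_diamond K) = two_pow K"
proof
  show "\<Union>(tau_diamond K) \<subseteq> two_pow K" using tau_diamond_subset_Pow[of K] by blast
next
  obtain A where "A \<subseteq> K" "countable A" "infinite A"
    using infinite_countable_subset' uncountable_infinite[OF K] by blast
  then have A: "A \<in> countably_infinite_subsets K" by (simp add: countably_infinite_subsets_def)
  show "two_pow K \<subseteq> \<Union>(tau_diamond K)"
  proof
    fix x assume "x \<in> two_pow K"
    then have "{x} \<subseteq> chi K A (restrict x A)" by (simp add: chi_def)
    moreover have "restrict x A \<in> two_pow A" by (simp add: two_pow_def)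
    ultimately have "{x} \<in> tau_diamond K"
      by (intro countable_subset_chi_in_tau_diamond[OF K A]) auto
    then show "x \<in> \<Union>(tau_diamond K)" by blast
  qed
qed

section \<open>Katetov reductions and families without infinite intersections in
  \<open>U\<close>\<close>

lemma katetov_le_tau_diamond_iff:
  assumes U: "ultrafilter_on X U" and np: "\<not> principal_on X U"
    and X: "countable X" and K: "uncountable K"
  shows "katetov_le (tau_diamond K) (dual_family X U) \<longleftrightarrow>
    (\<exists>A. (\<forall>k\<in>K. A k \<in> U) \<and> (\<forall>I\<subseteq>K. infinite I \<longrightarrow> (\<Inter>k\<in>I. A k) \<notin> U))"
proof
  assume "katetov_le (tau_diamond K) (dual_family X U)"
  then obtain f where f: "f \<in> X \<rightarrow> two_pow K"
    and dual: "\<And>B. B \<in> tau_diamond K \<Longrightarrow> f -` B \<inter> X \<in> dual_family X U"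
    unfolding katetov_le_def Union_dual_family[OF U np] Union_tau_diamond[OF K] by blast
  \<comment> \<open>The bit \<open>e k\<close> is the value that coordinate \<open>k\<close> of
    \<open>f n\<close> takes for \<open>U\<close>-almost all \<open>n\<close>.\<close>
  define e where "e k \<longleftrightarrow> {n\<in>X. f n k} \<in> U" for k
  define A where "A k = {n\<in>X. f n k = e k}" for k
  have A: "A k \<in> U" for k
  proof (cases "e k")
    case True
    then show ?thesis by (simp add: A_def e_def)
  next
    case False
    moreover have "A k = X - {n\<in>X. f n k}" using False by (auto simp: A_def)
    ultimately show ?thesis
      unfolding e_def using ultrafilter_onD(6)[OF U, of "{n\<in>X. f n k}"] by auto
  qed
  have "(\<Inter>k\<in>I. A k) \<notin> U" if I: "I \<subseteq> K" "infinite I" for I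
  proof
    assume IU: "(\<Inter>k\<in>I. A k) \<in> U"
    \<comment> \<open>Generators fix only countably many coordinates. Passing to \<open>J\<close>
      enlarges the intersection, so \<open>B\<close> still contains a member of
      \<open>U\<close>.\<close>
    obtain J where J: "J \<subseteq> I" "countable J" "infinite J"
      using infinite_countable_subset'[OF I(2)] by blast
    define B where "B = (\<Inter>k\<in>J. A k)"
    have BX: "B \<subseteq> X" using infinite_imp_nonempty[OF J(3)] by (auto simp: B_def A_def)
    have "f ` B \<subseteq> chi K J (restrict e J)"
    proof
      fix y assume "y \<in> f ` B"
      then obtain n where n: "n \<in> B" "y = f n" by blast
      have "restrict y J = restrict e J"
        using n by (auto simp: B_def A_def restrict_def)
      moreover have "y \<in> two_pow K" using n f BX by auto
      ultimately show "y \<in> chi K J (restrict e J)" by (simp add: chi_def)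
    qed
    \<comment> \<open>Countability of \<open>X\<close> enters here: the image of \<open>B\<close> is
      a countable, possibly finite, part of one \<open>chi\<close>.\<close>
    moreover have "countable (f ` B)" using countable_subset[OF BX X] by simp
    moreover have "J \<in> countably_infinite_subsets K"
      using J I(1) by (auto simp: countably_infinite_subsets_def)
    moreover have "restrict e J \<in> two_pow J" by (simp add: two_pow_def)
    ultimately have "f ` B \<in> tau_diamond K"
      using countable_subset_chi_in_tau_diamond[OF K] by blast
    then have "f -` (f ` B) \<inter> X \<notin> U"
      using dual mem_dual_family_iff[OF U] by blast
    moreover have "(\<Inter>k\<in>I. A k) \<subseteq> B"
      unfolding B_def using J(1) by (rule INF_superset_mono) simp
    then have "(\<Inter>k\<in>I. A k) \<subseteq> f -` (f ` B) \<inter> X" using BX by auto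
    then have "f -` (f ` B) \<inter> X \<in> U" by (rule ultrafilter_onD(5)[OF U IU]) (rule Int_lower2)
    ultimately show False by contradiction
  qed
  with A show "\<exists>A. (\<forall>k\<in>K. A k \<in> U) \<and> (\<forall>I\<subseteq>K. infinite I \<longrightarrow> (\<Inter>k\<in>I. A k) \<notin> U)"
    by (intro exI[of _ A]) simp
next
  assume "\<exists>A. (\<forall>k\<in>K. A k \<in> U) \<and> (\<forall>I\<subseteq>K. infinite I \<longrightarrow> (\<Inter>k\<in>I. A k) \<notin> U)"
  then obtain A where A: "\<And>k. k \<in> K \<Longrightarrow> A k \<in> U"
    and A': "\<And>I. I \<subseteq> K \<Longrightarrow> infinite I \<Longrightarrow> (\<Inter>k\<in>I. A k) \<notin> U" by blast
  \<comment> \<open>The point \<open>f n\<close> records which of the sets \<open>A k\<close>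
    contain \<open>n\<close>.\<close>
  define f where "f n = restrict (\<lambda>k. n \<in> A k) K" for n
  have f: "f \<in> X \<rightarrow> two_pow K" by (simp add: f_def two_pow_def)
  have "tau_diamond K \<subseteq> {B. B \<subseteq> two_pow K \<and> f -` B \<inter> X \<in> dual_family X U}"
  proof (rule tau_diamond_least)
    show "ideal_on (two_pow K) {B. B \<subseteq> two_pow K \<and> f -` B \<inter> X \<in> dual_family X U}"
      by (rule ideal_on_pushforward[OF ideal_on_dual_family[OF U]])
  next
    fix I g B assume I: "I \<in> countably_infinite_subsets K" and B: "B \<in> chi_omega K I g"
    have BI: "B \<subseteq> chi K I g"
      using B by (simp add: chi_omega_def countably_infinite_subsets_def)
    have IK: "I \<subseteq> K" "infinite I" using I by (auto simp: countably_infinite_subsets_def)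
    have "f -` B \<inter> X \<notin> U"
    proof
      assume V: "f -` B \<inter> X \<in> U"
      have g: "g k \<longleftrightarrow> n \<in> A k" if "n \<in> f -` B" "k \<in> I" for n k
      proof -
        have "restrict (f n) I = g" using that(1) BI by (auto simp: chi_def)
        then have "restrict (f n) I k = g k" by simp
        then show ?thesis using that(2) IK(1) by (auto simp: f_def)
      qed
      \<comment> \<open>On the preimage of \<open>B\<close>, membership in \<open>A k\<close> has
        the constant value \<open>g k\<close>. Two members of \<open>U\<close> meet, so this value
        is true and the preimage lies inside \<open>A k\<close>.\<close>
      have "f -` B \<inter> X \<subseteq> A k" if k: "k \<in> I" for k
      proof -
        have "f -` B \<inter> X \<inter> A k \<noteq> {}"
          using ultrafilter_onD(3)[OF U] ultrafilter_onD(4)[OF U V A] k IK(1) by (metis subsetD)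
        then show ?thesis using g k by blast
      qed
      then have "f -` B \<inter> X \<subseteq> (\<Inter>k\<in>I. A k)" by blast
      moreover have "(\<Inter>k\<in>I. A k) \<subseteq> X"
        using infinite_imp_nonempty[OF IK(2)] IK(1) ultrafilter_onD(1)[OF U A] by blast
      ultimately show False
        using ultrafilter_onD(5)[OF U V] A'[OF IK] by blast
    qed
    then show "B \<in> {B. B \<subseteq> two_pow K \<and> f -` B \<inter> X \<in> dual_family X U}"
      using BI mem_dual_family_iff[OF U] by (auto simp: chi_def)
  qed
  with f show "katetov_le (tau_diamond K) (dual_family X U)"
    unfolding katetov_le_def Union_dual_family[OF U np] Union_tau_diamond[OF K] by blast
qed

theorem theorem2p15:
  fixes U :: "nat set set" and \<kappa> :: "'k rel"
  assumes "ultrafilter_on UNIV U" and "\<not> principal_on UNIV U"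
    and "Card_order \<kappa>" and "uncountable (Field \<kappa>)"
  shows "tukey_le (Fpow (Field \<kappa>)) (\<subseteq>) U (\<supseteq>) \<longleftrightarrow>
         katetov_le (tau_diamond (Field \<kappa>)) (dual_family UNIV U)"
  unfolding tukey_le_Fpow_iff[OF assms(1)]
    katetov_le_tau_diamond_iff[OF assms(1,2) countableI_type assms(4)]
  by (rule refl)

end
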